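(* Let $k$ and $\ell$ be any positive integers. Then $A_k^{\ell-2}$ is a $(0,1)$-matrix in approximate lower diagonal form.
   Context: $C^a_b$ denotes the binomial coefficient "$a$ choose $b$". A $(0,1)$-matrix has all entries $0$ or $1$. A matrix $H$ is in approximate lower diagonal form if it has an identity matrix as a submatrix in its lower left corner (i.e. for some $p\ge 1$ the submatrix formed by the last $p$ rows and first $p$ columns of $H$ is $I_p$). If $X$ has $m$ columns and $Y$ is $m\times m$, then $X(Y)$ denotes the matrix obtained by pasting $Y$ below $X$. If $X$ is $n_1\times m_1$ and $Y$ is $n_2\times m_2$ with $n_1\ge n_2$, then $X\sqcup Y$ is the $n_1\times(m_1+m_2)$ matrix obtained by placing $Y$ to the right of $X$ with the bottom rows aligned and filling the remaining upper right $(n_1-n_2)\times m_2$ block with zeros; longer expressions are formed from left to right. For $k\ge 1$, $\underline{k}$ is the $1\times k$ matrix filled with ones. The matrices $A_k^{j}$ ($k\ge1$, $j\ge -1$) are defined by $A_k^{-1}=\underline{k}$ and, for $j\ge 0$, $A_k^{j}=A_k^{j-1}(I_{C^{k+j}_{j+1}})\sqcup A_{k-1}^{j-1}(I_{C^{k-1+j}_{j+1}})\sqcup\cdots\sqcup A_1^{j-1}(I_{C^{1+j}_{j+1}})$, where each identity matrix has as many rows as the matrix above it has columns. *)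

theory Defs
  imports "Jordan_Normal_Form.Matrix" "Jordan_Normal_Form.DL_Submatrix"
begin

definition zero_one_mat :: "'a :: {zero,one} mat \<Rightarrow> bool" where
  "zero_one_mat H \<longleftrightarrow> elements_mat H \<subseteq> {0, 1}"

definition approx_lower_diag :: "'a :: {zero,one} mat \<Rightarrow> bool" where
  "approx_lower_diag H \<longleftrightarrow>
     (\<exists>p. 1 \<le> p \<and> p \<le> dim_row H \<and> p \<le> dim_col H \<and>
       submatrix H {dim_row H - p..<dim_row H} {..<p} = 1\<^sub>m p)"

text \<open>The operation \<open>X \<squnion> Y\<close>, meaningful for \<open>dim_row Y \<le> dim_row X\<close>: the lower two blocks of
  the block matrix have no rows. Pasting \<open>Y\<close> below \<open>X\<close>, written \<open>X(Y)\<close> in the mathematical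
  text, is \<open>X @\<^sub>r Y\<close>.\<close>

definition paste_right :: "'a :: zero mat \<Rightarrow> 'a mat \<Rightarrow> 'a mat" (infixl \<open>\<squnion>\<^sub>m\<close> 65) where
  "X \<squnion>\<^sub>m Y = four_block_mat
     X (0\<^sub>m (dim_row X - dim_row Y) (dim_col Y) @\<^sub>r Y)
     (0\<^sub>m 0 (dim_col X)) (0\<^sub>m 0 (dim_col Y))"

text \<open>\<open>A_shift n k\<close> is the matrix with lower index \<open>k\<close> and upper index \<open>j = n - 1\<close>, so that
  the recursion starting at \<open>j = -1\<close> becomes primitive recursion. In the step below \<open>j = n\<close>, and
  the fold goes through the blocks for \<open>i = k, k - 1, \<dots>, 1\<close>, associating to the left.\<close>

primrec A_shift :: "nat \<Rightarrow> nat \<Rightarrow> 'a :: {zero,one} mat" where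
  "A_shift 0 k = mat 1 k (\<lambda>_. 1)"
| "A_shift (Suc n) k =
     (let B = (\<lambda>i. A_shift n i @\<^sub>r 1\<^sub>m ((i + n) choose (n + 1)))
      in foldl (\<squnion>\<^sub>m) (B k) (map B (rev [1..<k])))"

text \<open>Meaningful for \<open>k \<ge> 1\<close> and \<open>j \<ge> -1\<close>.\<close>

definition A_mat :: "nat \<Rightarrow> int \<Rightarrow> 'a :: {zero,one} mat" where
  "A_mat k j = A_shift (nat (j + 1)) k"

end

theory Submission
  imports Defs
begin

text \<open>Both properties are visible in the recursion. Entries stay in {0, 1} because pasting
  below and pasting to the right only combine given entries with zeros, and the pasted matrices are
  identities. For the lower left corner, the leftmost block of \<open>A_shift (Suc n) k\<close> is
  \<open>A_shift n k\<close> with an identity pasted below; further pasting to the right keeps the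
  rows and the first columns, so that identity stays in the corner. It spans the whole block because
  \<open>A_shift n k\<close> has exactly (k+n choose n+1) columns (\<open>dim_col_A_shift\<close>),
  by a hockey-stick sum. For n = 0 the matrix is a row of ones.\<close>

lemma index_append_rows:
  assumes "dim_col Y = dim_col X" "i < dim_row X + dim_row Y" "j < dim_col X"
  shows "(X @\<^sub>r Y) $$ (i, j) = (if i < dim_row X then X $$ (i, j) else Y $$ (i - dim_row X, j))"
  using assms by (simp add: append_rows_def)

lemma dim_append_rows [simp]:
  "dim_row (X @\<^sub>r Y) = dim_row X + dim_row Y" "dim_col (X @\<^sub>r Y) = dim_col X"
  by (simp_all add: append_rows_def)

lemma dim_paste_right [simp]:
  "dim_row (X \<squnion>\<^sub>m Y) = dim_row X" "dim_col (X \<squnion>\<^sub>m Y) = dim_col X + dim_col Y"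
  by (simp_all add: paste_right_def)

lemma index_paste_right_left:
  "i < dim_row X \<Longrightarrow> j < dim_col X \<Longrightarrow> (X \<squnion>\<^sub>m Y) $$ (i, j) = X $$ (i, j)"
  by (simp add: paste_right_def)

lemma index_paste_right_right:
  assumes "i < dim_row X" "dim_col X \<le> j" "j < dim_col X + dim_col Y"
  shows "(X \<squnion>\<^sub>m Y) $$ (i, j) =
    (0\<^sub>m (dim_row X - dim_row Y) (dim_col Y) @\<^sub>r Y) $$ (i, j - dim_col X)"
  using assms by (simp add: paste_right_def)

lemma zero_one_mat_iff:
  "zero_one_mat H \<longleftrightarrow> (\<forall>i<dim_row H. \<forall>j<dim_col H. H $$ (i, j) \<in> {0, 1})"
  unfolding zero_one_mat_def elements_mat_def by fastforce

lemma zero_one_mat_append_rows: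
  assumes "zero_one_mat X" "zero_one_mat Y" "dim_col Y = dim_col X"
  shows "zero_one_mat (X @\<^sub>r Y)"
  using assms by (auto simp: zero_one_mat_iff index_append_rows)

lemma zero_one_mat_zero: "zero_one_mat (0\<^sub>m m n)"
  and zero_one_mat_one: "zero_one_mat (1\<^sub>m n)"
  by (auto simp: zero_one_mat_iff)

lemma zero_one_mat_paste_right:
  assumes "zero_one_mat X" "zero_one_mat Y"
  shows "zero_one_mat (X \<squnion>\<^sub>m Y)"
proof -
  let ?Y = "0\<^sub>m (dim_row X - dim_row Y) (dim_col Y) @\<^sub>r Y"
  have Y: "zero_one_mat ?Y"
    by (intro zero_one_mat_append_rows zero_one_mat_zero assms) simp
  show ?thesis
    unfolding zero_one_mat_iff
  proof (intro allI impI)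
    fix i j assume ij: "i < dim_row (X \<squnion>\<^sub>m Y)" "j < dim_col (X \<squnion>\<^sub>m Y)"
    show "(X \<squnion>\<^sub>m Y) $$ (i, j) \<in> {0, 1}"
    proof (cases "j < dim_col X")
      case True
      with ij assms show ?thesis by (simp add: zero_one_mat_iff index_paste_right_left)
    next
      case False
      have "?Y $$ (i, j - dim_col X) \<in> {0, 1}"
        \<comment> \<open>With truncated subtraction the padded block has at least
          \<open>dim_row X\<close> rows even if \<open>Y\<close> is taller, so row \<open>i\<close>
          is in range.\<close>
        using Y[unfolded zero_one_mat_iff, rule_format, of i "j - dim_col X"] ij False by simp
      with ij False show ?thesis by (simp add: index_paste_right_right)
    qed
  qed
qed

lemma dim_foldl_paste_right:
  "dim_row (foldl (\<squnion>\<^sub>m) X Ys) = dim_row X"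
  "dim_col (foldl (\<squnion>\<^sub>m) X Ys) = dim_col X + sum_list (map dim_col Ys)"
  by (induction Ys arbitrary: X) simp_all

lemma index_foldl_paste_right:
  assumes "i < dim_row X" "j < dim_col X"
  shows "foldl (\<squnion>\<^sub>m) X Ys $$ (i, j) = X $$ (i, j)"
  using assms by (induction Ys arbitrary: X) (simp_all add: index_paste_right_left)

lemma zero_one_mat_foldl_paste_right:
  assumes "zero_one_mat X" "\<And>Y. Y \<in> set Ys \<Longrightarrow> zero_one_mat Y"
  shows "zero_one_mat (foldl (\<squnion>\<^sub>m) X Ys)"
  using assms by (induction Ys arbitrary: X) (simp_all add: zero_one_mat_paste_right)

text \<open>Exactly \<open>i\<close> members of the interval lie below \<open>a + i\<close>, and
  \<open>pick\<close> inverts this count.\<close>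

lemma pick_atLeastLessThan:
  assumes "i < b - a"
  shows "pick {a..<b} i = a + i"
proof -
  have "{x \<in> {a..<b}. x < a + i} = {a..<a + i}" using assms by auto
  then have "card {x \<in> {a..<b}. x < a + i} = i" by simp
  moreover have "a + i \<in> {a..<b}" using assms by auto
  ultimately show ?thesis using pick_card_in_set by metis
qed

text \<open>Replaces the \<open>submatrix\<close> condition by one on entries: on the last p rows
  \<open>pick\<close> shifts the index, on the first p columns it is the identity.\<close>

lemma approx_lower_diagI:
  assumes "1 \<le> p" "p \<le> dim_row H" "p \<le> dim_col H"
    and "\<And>i j. i < p \<Longrightarrow> j < p \<Longrightarrow> H $$ (dim_row H - p + i, j) = (if i = j then 1 else 0)"
  shows "approx_lower_diag H"
proof -
  let ?I = "{dim_row H - p..<dim_row H}" and ?J = "{..<p}"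
  have "{i. i < dim_row H \<and> i \<in> ?I} = ?I" "{j. j < dim_col H \<and> j \<in> ?J} = {0..<p}"
    using assms(3) by auto
  then have card: "card {i. i < dim_row H \<and> i \<in> ?I} = p" "card {j. j < dim_col H \<and> j \<in> ?J} = p"
    using assms(2) by simp_all
  have "submatrix H ?I ?J = 1\<^sub>m p"
  proof (rule eq_matI)
    fix i j assume "i < dim_row (1\<^sub>m p :: 'a mat)" "j < dim_col (1\<^sub>m p :: 'a mat)"
    then have ij: "i < p" "j < p" by simp_all
    have "pick ?I i = dim_row H - p + i" "pick ?J j = j"
      using ij assms(2) pick_atLeastLessThan[of i "dim_row H" "dim_row H - p"]
        pick_atLeastLessThan[of j p 0] by (simp_all add: lessThan_atLeast0)
    with ij card show "submatrix H ?I ?J $$ (i, j) = 1\<^sub>m p $$ (i, j)"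
      by (subst submatrix_index) (simp_all add: assms(4))
  qed (use card in \<open>simp_all add: dim_submatrix\<close>)
  with assms(1-3) show ?thesis unfolding approx_lower_diag_def by blast
qed

text \<open>The hockey-stick identity; it counts the columns of the blocks to the right of the first
  one.\<close>

lemma sum_choose_shift:
  "(\<Sum>i=1..<k. (i + n) choose (n + 1)) = (k + n) choose (n + 2)"
proof (induction k)
  case (Suc k)
  \<comment> \<open>The term for \<open>k\<close> splits off only when \<open>k\<close> is at least
    1; for \<open>k = 0\<close> both sides vanish.\<close>
  then show ?case by (cases k) simp_all
qed simp

text \<open>The number of columns agrees with the order of the identity matrix pasted below, so that
  \<open>@\<^sub>r\<close> has its intended meaning in the recursion.\<close>

lemma dim_col_A_shift:
  "k > 0 \<Longrightarrow> dim_col (A_shift n k :: 'a :: {zero,one} mat) = (k + n) choose (n + 1)"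
proof (induction n arbitrary: k)
  case (Suc n)
  have "map (dim_col \<circ> (\<lambda>i. (A_shift n i :: 'a mat) @\<^sub>r 1\<^sub>m ((i + n) choose (n + 1)))) (rev [1..<k])
      = rev (map (\<lambda>i. (i + n) choose (n + 1)) [1..<k])"
    using Suc.IH by (auto simp: rev_map)
  then have "dim_col (A_shift (Suc n) k :: 'a mat) =
      ((k + n) choose (n + 1)) + (\<Sum>i=1..<k. (i + n) choose (n + 1))"
    using Suc.IH[OF Suc.prems]
    by (simp add: Let_def dim_foldl_paste_right sum_list_rev interv_sum_list_conv_sum_set_nat
        del: upt_Suc binomial_Suc_Suc)
  \<comment> \<open>Pascal's rule merges the first block's columns with those of the rest.\<close>
  then show ?case unfolding sum_choose_shift by simp
qed simp

lemma zero_one_mat_A_shift: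
  "k > 0 \<Longrightarrow> zero_one_mat (A_shift n k :: 'a :: {zero,one} mat)"
proof (induction n arbitrary: k)
  case 0
  show ?case by (simp add: zero_one_mat_iff)
next
  case (Suc n)
  have "zero_one_mat ((A_shift n i :: 'a mat) @\<^sub>r 1\<^sub>m ((i + n) choose (n + 1)))" if "i > 0" for i
    using that
    by (intro zero_one_mat_append_rows zero_one_mat_one Suc.IH) (simp_all add: dim_col_A_shift)
  then show ?case using Suc.prems
    unfolding A_shift.simps Let_def
    by (intro zero_one_mat_foldl_paste_right) auto
qed

text \<open>The identity fills the last p rows of the first block across all its p columns, and the
  fold leaves that block unchanged.\<close>

lemma approx_lower_diag_append_one:
  assumes "dim_col X = p" "1 \<le> p"
  shows "approx_lower_diag (foldl (\<squnion>\<^sub>m) (X @\<^sub>r 1\<^sub>m p) Ys)"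
  using assms
  by (intro approx_lower_diagI[of p])
    (simp_all add: dim_foldl_paste_right index_foldl_paste_right index_append_rows)

lemma approx_lower_diag_A_shift:
  assumes "k > 0"
  shows "approx_lower_diag (A_shift n k)"
proof (cases n)
  case 0
  \<comment> \<open>In a row of ones the first entry is a 1 by 1 identity.\<close>
  with assms show ?thesis by (intro approx_lower_diagI[of 1]) auto
next
  case (Suc m)
  have "1 \<le> (k + m) choose (m + 1)" using assms by (simp add: Suc_le_eq del: binomial_Suc_Suc)
  with Suc assms show ?thesis
    by (simp only: A_shift.simps Let_def approx_lower_diag_append_one dim_col_A_shift)
qed

theorem corollary3p7:
  fixes k l :: nat
  assumes "k > 0" and "l > 0"
  shows "zero_one_mat (A_mat k (int l - 2) :: 'a :: zero_neq_one mat) \<and>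
         approx_lower_diag (A_mat k (int l - 2) :: 'a mat)"
  unfolding A_mat_def
  using assms(1) zero_one_mat_A_shift approx_lower_diag_A_shift by blast

end
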